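(* Let $\mathcal P\subseteq\mathbb R^N$ be closed, convex and CP admissible. Then $\mathcal P=\mathcal W+\mathcal K$, where $\mathcal W\subseteq\mathcal P$ is a compact, convex and CP admissible set, and $\mathcal K\subseteq\mathcal P$ is a closed, convex and CP admissible cone.
   Context: For $x\in\mathbb R^N$, $\mathrm{supp}(x)=\{i: x_i\ne0\}$. For an index set $\mathcal I\subseteq\{1,\dots,N\}$, $\pi_{\mathcal I}:\mathbb R^N\to\mathbb R^N$ keeps the coordinates in $\mathcal I$ and sets all others to $0$. A nonempty set $\mathcal P\subseteq\mathbb R^N$ is coordinate projection admissible (CP admissible) if for any $x\in\mathcal P$ and any index set $\mathcal J\subseteq\mathrm{supp}(x)$ (possibly empty), $\pi_{\mathcal J}(x)\in\mathcal P$. The sum is the Minkowski sum (the claim is the existence of such $\mathcal W$ and $\mathcal K$); cones contain the zero vector. *)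

theory Defs
  imports "HOL-Analysis.Analysis"
begin

definition supp :: "real ^ 'n \<Rightarrow> 'n set" where
  "supp x = {i. x $ i \<noteq> 0}"

definition coord_proj :: "'n set \<Rightarrow> real ^ 'n \<Rightarrow> real ^ 'n" where
  "coord_proj I x = (\<chi> i. if i \<in> I then x $ i else 0)"

definition CP_admissible :: "(real ^ 'n) set \<Rightarrow> bool" where
  "CP_admissible P \<longleftrightarrow>
     P \<noteq> {} \<and> (\<forall>x\<in>P. \<forall>J\<subseteq>supp x. coord_proj J x \<in> P)"

end

theory Submission
  imports Defs
begin

text \<open>
  Take for \<open>K\<close> the recession cone of \<open>P\<close>. For a sign \<open>s\<close> and a coordinate \<open>i\<close>, either \<open>s e\<^sub>i\<close> is
  a recession direction or \<open>s x\<^sub>i\<close> is bounded above on \<open>P\<close>, because \<open>P\<close> contains the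
  projection \<open>x\<^sub>i e\<^sub>i\<close> of each of its points. Let \<open>W\<close> be the part of \<open>P\<close> where \<open>s x\<^sub>i \<le> 0\<close> for
  every recession direction \<open>s e\<^sub>i\<close>; it is bounded. For \<open>x\<close> in \<open>P\<close>, splitting off the
  coordinates with \<open>x\<^sub>i e\<^sub>i\<close> in \<open>K\<close> decomposes \<open>x\<close>.
\<close>

text \<open>Only rays from the origin are tested. For a closed convex \<open>P\<close> containing 0
  this is the usual recession cone, whose rays may start at any point of \<open>P\<close>.\<close>

definition recession_cone :: "'a::real_vector set \<Rightarrow> 'a set" where
  "recession_cone P = {d. \<forall>t\<ge>0. t *\<^sub>R d \<in> P}"

lemma recession_cone_subset: "recession_cone P \<subseteq> P"
  unfolding recession_cone_def by (metis (lifting) mem_Collect_eq scaleR_one subsetI zero_le_one)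

lemma cone_recession_cone: "cone (recession_cone P)"
  unfolding recession_cone_def cone_def by auto

lemma convex_recession_cone:
  assumes "convex P"
  shows "convex (recession_cone P)"
proof (rule convexI)
  fix x y and u v :: real
  assume *: "x \<in> recession_cone P" "y \<in> recession_cone P" "0 \<le> u" "0 \<le> v" "u + v = 1"
  have "t *\<^sub>R (u *\<^sub>R x + v *\<^sub>R y) \<in> P" if "t \<ge> 0" for t
  proof -
    have "u *\<^sub>R (t *\<^sub>R x) + v *\<^sub>R (t *\<^sub>R y) \<in> P"
      using * that by (intro convexD[OF assms]) (auto simp: recession_cone_def)
    then show ?thesis
      by (simp add: scaleR_add_right mult.commute)
  qed
  then show "u *\<^sub>R x + v *\<^sub>R y \<in> recession_cone P"
    by (simp add: recession_cone_def)
qed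

lemma closed_recession_cone:
  fixes P :: "'a::real_normed_vector set"
  assumes "closed P"
  shows "closed (recession_cone P)"
proof -
  have "recession_cone P = (\<Inter>t\<in>{0..}. (\<lambda>d. t *\<^sub>R d) -` P)"
    by (auto simp: recession_cone_def)
  moreover have "closed ((\<lambda>d. t *\<^sub>R d) -` P)" for t
    by (intro closed_vimage assms continuous_intros)
  ultimately show ?thesis
    by auto
qed

text \<open>The point \<open>w + d\<close> is the limit of the convex combinations of
  \<open>w\<close> and the far point \<open>n d\<close> with weights \<open>1 - 1/n\<close> and
  \<open>1/n\<close>; closedness then gives membership.\<close>

lemma recession_cone_add:
  fixes P :: "'a::real_normed_vector set"
  assumes "closed P" "convex P" "w \<in> P" "d \<in> recession_cone P"
  shows "w + d \<in> P"
proof -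
  define f where "f n = (1 - inverse (real (Suc n))) *\<^sub>R w + d" for n
  have "f n \<in> P" for n
  proof -
    have "(1 - inverse (real (Suc n))) *\<^sub>R w + inverse (real (Suc n)) *\<^sub>R (real (Suc n) *\<^sub>R d) \<in> P"
      using assms(3,4)
      by (intro convexD[OF assms(2)]) (auto simp: recession_cone_def inverse_le_1_iff)
    then show ?thesis
      by (simp add: f_def del: of_nat_Suc)
  qed
  moreover have "f \<longlonglongrightarrow> (1 - 0) *\<^sub>R w + d"
    unfolding f_def by (intro tendsto_intros LIMSEQ_inverse_real_of_nat)
  ultimately show ?thesis
    using closed_sequentially[OF assms(1), of f] by simp
qed

lemma coord_proj_nth [simp]: "coord_proj J x $ i = (if i \<in> J then x $ i else 0)"
  by (simp add: coord_proj_def)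

lemma CP_admissibleI:
  assumes "0 \<in> P" "\<And>x J. x \<in> P \<Longrightarrow> coord_proj J x \<in> P"
  shows "CP_admissible P"
  using assms by (auto simp: CP_admissible_def)

lemma coord_proj_mem:
  assumes "CP_admissible P" "x \<in> P"
  shows "coord_proj J x \<in> P"
proof -
  have "coord_proj J x = coord_proj (J \<inter> supp x) x"
    by (auto simp: supp_def vec_eq_iff)
  then show ?thesis
    using assms by (auto simp: CP_admissible_def)
qed

lemma zero_mem_CP_admissible:
  assumes "CP_admissible P"
  shows "0 \<in> P"
proof -
  obtain x where "x \<in> P"
    using assms by (auto simp: CP_admissible_def)
  moreover have "coord_proj {} x = 0"
    by (simp add: vec_eq_iff)
  ultimately show ?thesis
    using coord_proj_mem[OF assms] by metis
qed

text \<open>Projection commutes with scaling, so it carries a ray in \<open>P\<close> to a ray in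
  \<open>P\<close>.\<close>

lemma CP_admissible_recession_cone:
  assumes "CP_admissible P"
  shows "CP_admissible (recession_cone P)"
proof (rule CP_admissibleI)
  show "0 \<in> recession_cone P"
    using zero_mem_CP_admissible[OF assms] by (simp add: recession_cone_def)
next
  fix x J
  assume x: "x \<in> recession_cone P"
  have "t *\<^sub>R coord_proj J x = coord_proj J (t *\<^sub>R x)" for t
    by (simp add: vec_eq_iff)
  then show "coord_proj J x \<in> recession_cone P"
    using x coord_proj_mem[OF assms] by (simp add: recession_cone_def)
qed

lemma axis_mem_CP_admissible:
  assumes "CP_admissible P" "x \<in> P"
  shows "axis i (x $ i) \<in> P"
proof -
  have "coord_proj {i} x = axis i (x $ i)"
    by (auto simp: axis_def vec_eq_iff)
  then show ?thesis
    using coord_proj_mem[OF assms] by metis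
qed

text \<open>Some \<open>t\<close> has \<open>t *\<^sub>R axis i s\<close> outside \<open>P\<close>,
  and this \<open>t\<close> is the bound: if \<open>s * x $ i\<close> exceeded it, the segment from
  0 to \<open>axis i (x $ i)\<close>, which lies in \<open>P\<close>, would pass through that
  point.\<close>

lemma bounded_above_if_not_recession:
  fixes P :: "(real ^ 'n) set"
  assumes "convex P" "CP_admissible P" "\<bar>s\<bar> = 1" "axis i s \<notin> recession_cone P"
  shows "\<exists>B. \<forall>x\<in>P. s * x $ i \<le> B"
proof -
  obtain t where t: "t \<ge> 0" "t *\<^sub>R axis i s \<notin> P"
    using assms(4) by (auto simp: recession_cone_def)
  have "s * x $ i \<le> t" if "x \<in> P" for x
  proof (rule ccontr)
    assume less: "\<not> s * x $ i \<le> t"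
    define c where "c = t / (s * x $ i)"
    have c: "0 \<le> c" "c \<le> 1"
      using less t(1) by (auto simp: c_def)
    have "c *\<^sub>R axis i (x $ i) + (1 - c) *\<^sub>R 0 \<in> P"
      using c zero_mem_CP_admissible[OF assms(2)] axis_mem_CP_admissible[OF assms(2) that]
      by (intro convexD[OF assms(1)]) auto
    \<comment> \<open>A sign is its own inverse, so \<open>t / s = t * s\<close>.\<close>
    moreover have "c * x $ i = t * s"
      using less t(1) assms(3) by (auto simp: c_def abs_if split: if_splits)
    then have "c *\<^sub>R axis i (x $ i) = t *\<^sub>R axis i s"
      by (simp add: vec_eq_iff axis_def)
    ultimately show False
      using t(2) by simp
  qed
  then show ?thesis by blast
qed

theorem proposition4p3:
  fixes P :: "(real ^ 'n) set"
  assumes "closed P" and "convex P" and "CP_admissible P"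
  shows "\<exists>W K. P = W + K
           \<and> W \<subseteq> P \<and> compact W \<and> convex W \<and> CP_admissible W
           \<and> K \<subseteq> P \<and> closed K \<and> convex K \<and> CP_admissible K \<and> cone K"
proof -
  define K where "K = recession_cone P"
  \<comment> \<open>Each constraint is a closed half-space with 0 on its boundary that involves a
    single coordinate, so it survives setting coordinates to 0. If both signs of a coordinate lie in
    \<open>K\<close>, that coordinate vanishes on \<open>W\<close>.\<close>
  define W where "W = P \<inter> (\<Inter>(i, s)\<in>{(i, s). \<bar>s\<bar> = 1 \<and> axis i s \<in> K}. {x. s * x $ i \<le> 0})"
  note K_cone = cone_recession_cone[of P, folded K_def]
  note K_convex = convex_recession_cone[OF assms(2), folded K_def]
  note zero_K = zero_mem_CP_admissible[OF CP_admissible_recession_cone[OF assms(3)], folded K_def]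
  have K_add: "x + y \<in> K" if "x \<in> K" "y \<in> K" for x y
    using convex_cone[of K] K_convex K_cone that by blast
  have W_iff: "x \<in> W \<longleftrightarrow> x \<in> P \<and> (\<forall>i s. \<bar>s\<bar> = 1 \<longrightarrow> axis i s \<in> K \<longrightarrow> s * x $ i \<le> 0)" for x
    by (auto simp: W_def)
  have "closed W"
    unfolding W_def using assms(1)
    by (intro closed_Int closed_INT) (auto intro!: closed_Collect_le continuous_intros)
  have "convex {x :: real ^ 'n. s * x $ i \<le> 0}" for s i
    using convex_halfspace_le[of "axis i s" 0] by (simp add: inner_axis' mult.commute)
  then have "convex W"
    unfolding W_def using assms(2) by (intro convex_Int convex_INT) auto
  have "CP_admissible W"
  proof (rule CP_admissibleI)
    show "0 \<in> W"
      using zero_mem_CP_admissible[OF assms(3)] by (simp add: W_iff)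
    show "coord_proj J x \<in> W" if "x \<in> W" for J x
      using that coord_proj_mem[OF assms(3)] by (simp add: W_iff)
  qed
  \<comment> \<open>For directions in \<open>K\<close> the bound is 0 by the choice of
    \<open>W\<close>; for the others it is inherited from \<open>P\<close>.\<close>
  have "\<exists>B. \<forall>x\<in>W. s * x $ i \<le> B" if "\<bar>s\<bar> = 1" for s i
  proof (cases "axis i s \<in> K")
    case True
    then show ?thesis
      using that W_iff by blast
  next
    case False
    then show ?thesis
      using bounded_above_if_not_recession[OF assms(2,3) that] W_iff unfolding K_def by blast
  qed
  then obtain B where B: "\<And>s i x. \<bar>s\<bar> = 1 \<Longrightarrow> x \<in> W \<Longrightarrow> s * x $ i \<le> B s i"
    by metis
  have "\<bar>x $ i\<bar> \<le> max (B 1 i) (B (- 1) i)" if "x \<in> W" for x i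
    using B[OF _ that, of 1 i] B[OF _ that, of "-1" i] by (simp add: abs_if le_max_iff_disj)
  then have "norm x \<le> (\<Sum>i\<in>UNIV. max (B 1 i) (B (- 1) i))" if "x \<in> W" for x
    using that norm_le_l1_cart[of x] by (meson order_trans sum_mono)
  then have "bounded W"
    by (auto simp: bounded_iff)
  with \<open>closed W\<close> have "compact W"
    by (simp add: compact_eq_bounded_closed)
  have "x \<in> W + K" if "x \<in> P" for x
  proof -
    \<comment> \<open>The coordinates to be split off; those with \<open>x $ i = 0\<close> are among
      them, since 0 lies in \<open>K\<close>.\<close>
    define J where "J = {i. axis i (x $ i) \<in> K}"
    have "coord_proj (- J) x \<in> W"
    proof -
      \<comment> \<open>A positive \<open>s * x $ i\<close> would make \<open>axis i (x $ i)\<close>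
        a positive multiple of \<open>axis i s\<close>, hence an element of the cone
        \<open>K\<close>, forcing \<open>i\<close> into \<open>J\<close>.\<close>
      have "s * x $ i \<le> 0" if "\<bar>s\<bar> = 1" "axis i s \<in> K" "i \<notin> J" for s i
      proof (rule ccontr)
        assume "\<not> s * x $ i \<le> 0"
        moreover from this have "(s * x $ i) *\<^sub>R axis i s \<in> K"
          using that K_cone by (simp add: cone_def)
        moreover have "(s * x $ i) *\<^sub>R axis i s = axis i (x $ i)"
          using that(1) by (auto simp: vec_eq_iff axis_def abs_if split: if_splits)
        ultimately show False
          using that(3) by (simp add: J_def)
      qed
      then show ?thesis
        using coord_proj_mem[OF assms(3) that] by (simp add: W_iff)
    qed
    moreover have "coord_proj J x \<in> K"
    proof -
      have "coord_proj J x = (\<Sum>i\<in>J. axis i (x $ i))"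
        by (simp add: vec_eq_iff axis_def)
      \<comment> \<open>A convex cone is closed under addition; passing to subsets \<open>I\<close>
        of \<open>J\<close> keeps \<open>J\<close> fixed during the induction.\<close>
      moreover have "(\<Sum>i\<in>I. axis i (x $ i)) \<in> K" if "I \<subseteq> J" for I
        using finite[of I] that
        by (induction I rule: finite_induct)
           (use zero_K K_add in \<open>auto simp: J_def\<close>)
      ultimately show ?thesis by auto
    qed
    moreover have "x = coord_proj (- J) x + coord_proj J x"
      by (simp add: vec_eq_iff)
    ultimately show ?thesis
      by (metis set_plus_intro)
  qed
  moreover have "W + K \<subseteq> P"
    using recession_cone_add[OF assms(1,2)] by (auto simp: set_plus_def W_iff K_def)
  ultimately have "P = W + K"
    by auto
  moreover have "W \<subseteq> P"
    by (auto simp: W_iff)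
  ultimately show ?thesis
    using \<open>compact W\<close> \<open>convex W\<close> \<open>CP_admissible W\<close> K_convex K_cone
      recession_cone_subset[of P] closed_recession_cone[OF assms(1)]
      CP_admissible_recession_cone[OF assms(3)]
    unfolding K_def by blast
qed

end
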